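(* Let $(\mathfrak{g},\omega)$ be a finite dimensional symplectic Lie algebra over a field of characteristic $0$, and let $\alpha^{\mathrm{a}},\alpha^{\mathrm{s}}$ be the products on $\mathfrak{g}$ given by $$\alpha^{\mathrm{a}}(u,v)=-\mathrm{ad}_u^*v,\qquad \alpha^{\mathrm{s}}(u,v)=\tfrac13\left(\mathrm{ad}_uv-\mathrm{ad}_u^*v\right),$$ where $\mathrm{ad}_u^*$ is the adjoint of $\mathrm{ad}_u$ with respect to $\omega$. Then the following assertions are equivalent: 1. $\alpha^{\mathrm{a}}$ is quasi-canonical. 2. $\alpha^{\mathrm{s}}$ is quasi-canonical. 3. $\mathfrak{g}$ is 2-nilpotent and, for all $u,v\in\mathfrak{g}$, $[\mathrm{ad}_u,\mathrm{ad}_v^*]=0$. Moreover, if one of these conditions holds then $(\mathfrak{g},\alpha^{\mathrm{a}})$ and $(\mathfrak{g},\alpha^{\mathrm{s}})$ are both associative $\mathrm{LR}$-algebras.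
   Context: A symplectic Lie algebra $(\mathfrak{g},\omega)$ is a Lie algebra with a nondegenerate skew-symmetric bilinear form $\omega$ such that $\omega([u,v],w)+\omega([v,w],u)+\omega([w,u],v)=0$ for all $u,v,w$. The adjoint $F^*$ of $F\in\mathrm{End}(\mathfrak{g})$ is defined by $\omega(Fu,v)=\omega(u,F^*v)$. A Lie algebra is 2-nilpotent if $[[u,v],w]=0$ for all $u,v,w$. A bilinear product $\alpha$ on a finite dimensional Lie algebra $\mathfrak{g}$, with $\mathrm{L}_uv=\alpha(u,v)$, is quasi-canonical if it is Lie-admissible ($\alpha(u,v)-\alpha(v,u)=[u,v]$), bi-invariant ($[u,\alpha(v,w)]=\alpha([u,v],w)+\alpha(v,[u,w])$), and $[\mathrm{L}_u,\mathrm{L}_v]-\mathrm{L}_{[u,v]}=-\frac14\mathrm{ad}_{[u,v]}$, for all $u,v,w\in\mathfrak{g}$. An algebra with left and right multiplications $\mathrm{L}_u,\mathrm{R}_u$ is an $\mathrm{LR}$-algebra if $[\mathrm{L}_u,\mathrm{L}_v]=[\mathrm{R}_u,\mathrm{R}_v]=0$ for all $u,v$. *)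

theory Defs
  imports Complex_Main
begin

definition bilinear_map ::
    "('k::field \<Rightarrow> 'v::ab_group_add \<Rightarrow> 'v) \<Rightarrow> ('k \<Rightarrow> 'w::ab_group_add \<Rightarrow> 'w) \<Rightarrow> ('v \<Rightarrow> 'v \<Rightarrow> 'w) \<Rightarrow> bool"
  where "bilinear_map s1 s2 f \<longleftrightarrow>
    (\<forall>u. Vector_Spaces.linear s1 s2 (\<lambda>v. f u v)) \<and>
    (\<forall>v. Vector_Spaces.linear s1 s2 (\<lambda>u. f u v))"

text \<open>The parameter \<open>Basis\<close> only witnesses finite dimensionality; nothing below depends on its choice.\<close>

locale fd_lie_algebra = finite_dimensional_vector_space scale Basis
  for scale :: "'k::field \<Rightarrow> 'v::ab_group_add \<Rightarrow> 'v" and Basis :: "'v set" +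
  fixes bracket :: "'v \<Rightarrow> 'v \<Rightarrow> 'v"
  assumes bracket_bilinear: "bilinear_map scale scale bracket"
    and bracket_alternating: "bracket u u = 0"
    and jacobi: "bracket u (bracket v w) + bracket v (bracket w u) + bracket w (bracket u v) = 0"

locale symplectic_lie_algebra = fd_lie_algebra scale Basis bracket
  for scale :: "'k::field \<Rightarrow> 'v::ab_group_add \<Rightarrow> 'v" and Basis :: "'v set"
    and bracket :: "'v \<Rightarrow> 'v \<Rightarrow> 'v" +
  fixes \<omega> :: "'v \<Rightarrow> 'v \<Rightarrow> 'k"
  assumes form_bilinear: "bilinear_map scale (*) \<omega>"
    and form_skew: "\<omega> u v = - \<omega> v u"
    and form_nondegenerate: "(\<forall>v. \<omega> u v = 0) \<Longrightarrow> u = 0"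
    and form_cocycle: "\<omega> (bracket u v) w + \<omega> (bracket v w) u + \<omega> (bracket w u) v = 0"

text \<open>The description is proper for linear \<open>F\<close>: see \<open>adjoint_ex1\<close> below.\<close>

definition form_adjoint :: "('v \<Rightarrow> 'v \<Rightarrow> 'k) \<Rightarrow> ('v \<Rightarrow> 'v) \<Rightarrow> 'v \<Rightarrow> 'v"
  where "form_adjoint \<omega> F = (THE G. \<forall>u v. \<omega> (F u) v = \<omega> u (G v))"

definition commutator :: "('v::ab_group_add \<Rightarrow> 'v) \<Rightarrow> ('v \<Rightarrow> 'v) \<Rightarrow> 'v \<Rightarrow> 'v"
  where "commutator F G = (\<lambda>x. F (G x) - G (F x))"

definition left_mult :: "('v \<Rightarrow> 'v \<Rightarrow> 'v) \<Rightarrow> 'v \<Rightarrow> 'v \<Rightarrow> 'v"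
  where "left_mult \<alpha> u = (\<lambda>v. \<alpha> u v)"

definition right_mult :: "('v \<Rightarrow> 'v \<Rightarrow> 'v) \<Rightarrow> 'v \<Rightarrow> 'v \<Rightarrow> 'v"
  where "right_mult \<alpha> u = (\<lambda>v. \<alpha> v u)"

definition ad :: "('v \<Rightarrow> 'v \<Rightarrow> 'v) \<Rightarrow> 'v \<Rightarrow> 'v \<Rightarrow> 'v"
  where "ad bracket u = (\<lambda>v. bracket u v)"

definition two_nilpotent :: "('v::ab_group_add \<Rightarrow> 'v \<Rightarrow> 'v) \<Rightarrow> bool"
  where "two_nilpotent bracket \<longleftrightarrow> (\<forall>u v w. bracket (bracket u v) w = 0)"

definition lie_admissible :: "('v::ab_group_add \<Rightarrow> 'v \<Rightarrow> 'v) \<Rightarrow> ('v \<Rightarrow> 'v \<Rightarrow> 'v) \<Rightarrow> bool"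
  where "lie_admissible bracket \<alpha> \<longleftrightarrow> (\<forall>u v. \<alpha> u v - \<alpha> v u = bracket u v)"

definition bi_invariant :: "('v::ab_group_add \<Rightarrow> 'v \<Rightarrow> 'v) \<Rightarrow> ('v \<Rightarrow> 'v \<Rightarrow> 'v) \<Rightarrow> bool"
  where "bi_invariant bracket \<alpha> \<longleftrightarrow>
    (\<forall>u v w. bracket u (\<alpha> v w) = \<alpha> (bracket u v) w + \<alpha> v (bracket u w))"

definition quasi_canonical ::
    "('k::field \<Rightarrow> 'v::ab_group_add \<Rightarrow> 'v) \<Rightarrow> ('v \<Rightarrow> 'v \<Rightarrow> 'v) \<Rightarrow> ('v \<Rightarrow> 'v \<Rightarrow> 'v) \<Rightarrow> bool"
  where "quasi_canonical scale bracket \<alpha> \<longleftrightarrow>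
    bilinear_map scale scale \<alpha> \<and> lie_admissible bracket \<alpha> \<and> bi_invariant bracket \<alpha> \<and>
    (\<forall>u v w. commutator (left_mult \<alpha> u) (left_mult \<alpha> v) w - left_mult \<alpha> (bracket u v) w
      = scale (- (1 / 4)) (ad bracket (bracket u v) w))"

definition associative_product :: "('v \<Rightarrow> 'v \<Rightarrow> 'v) \<Rightarrow> bool"
  where "associative_product \<alpha> \<longleftrightarrow> (\<forall>u v w. \<alpha> (\<alpha> u v) w = \<alpha> u (\<alpha> v w))"

definition LR_algebra ::
    "('k::field \<Rightarrow> 'v::ab_group_add \<Rightarrow> 'v) \<Rightarrow> ('v \<Rightarrow> 'v \<Rightarrow> 'v) \<Rightarrow> bool"
  where "LR_algebra scale \<alpha> \<longleftrightarrow> bilinear_map scale scale \<alpha> \<and>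
    (\<forall>u v. commutator (left_mult \<alpha> u) (left_mult \<alpha> v) = (\<lambda>_. 0) \<and>
           commutator (right_mult \<alpha> u) (right_mult \<alpha> v) = (\<lambda>_. 0))"

definition alpha_a ::
    "('v::ab_group_add \<Rightarrow> 'v \<Rightarrow> 'v) \<Rightarrow> ('v \<Rightarrow> 'v \<Rightarrow> 'k) \<Rightarrow> 'v \<Rightarrow> 'v \<Rightarrow> 'v"
  where "alpha_a bracket \<omega> u v = - form_adjoint \<omega> (ad bracket u) v"

definition alpha_s ::
    "('k::field \<Rightarrow> 'v::ab_group_add \<Rightarrow> 'v) \<Rightarrow> ('v \<Rightarrow> 'v \<Rightarrow> 'v) \<Rightarrow> ('v \<Rightarrow> 'v \<Rightarrow> 'k) \<Rightarrow> 'v \<Rightarrow> 'v \<Rightarrow> 'v"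
  where "alpha_s scale bracket \<omega> u v =
    scale (1 / 3) (ad bracket u v - form_adjoint \<omega> (ad bracket u) v)"

context symplectic_lie_algebra
begin

lemma form_linear_left: "Vector_Spaces.linear scale (*) (\<lambda>u. \<omega> u v)"
  and form_linear_right: "Vector_Spaces.linear scale (*) (\<lambda>v. \<omega> u v)"
  using form_bilinear by (simp_all add: bilinear_map_def)

lemma form_simps:
  "\<omega> (x + y) v = \<omega> x v + \<omega> y v" "\<omega> (scale c x) v = c * \<omega> x v"
  "\<omega> v (x + y) = \<omega> v x + \<omega> v y" "\<omega> v (scale c x) = c * \<omega> v x"
  using form_linear_left[of v] form_linear_right[of v]
  by (simp_all add: linear_iff_module_hom module_hom_iff)

lemma form_right_cancel:
  assumes "\<And>u. \<omega> u x = \<omega> u y"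
  shows "x = y"
proof -
  have "\<omega> (x - y) v = 0" for v
  proof -
    have "\<omega> x v = \<omega> y v" using assms[of v] form_skew by metis
    then show ?thesis using form_simps(1)[of "x - y" y v] by simp
  qed
  then show ?thesis
    using form_nondegenerate[of "x - y"] by simp
qed

lemma form_represents:
  assumes f: "Vector_Spaces.linear scale (*) f"
  shows "\<exists>w. \<forall>u. f u = \<omega> u w"
proof -
  let ?T = "\<lambda>w. \<Sum>b\<in>Basis. scale (\<omega> b w) b"
  have coeffs: "\<forall>b\<in>Basis. c b = d b"
    if "(\<Sum>b\<in>Basis. scale (c b) b) = (\<Sum>b\<in>Basis. scale (d b) b)" for c d
  proof -
    have "(\<Sum>b\<in>Basis. scale (c b - d b) b) = 0"
      using that by (simp add: scale_left_diff_distrib sum_subtractf)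
    then show ?thesis
      using independentD[OF independent_Basis finite_Basis subset_refl, of "\<lambda>b. c b - d b"]
      by auto
  qed
  have basis_ext: "g = h" if "Vector_Spaces.linear scale (*) g" "Vector_Spaces.linear scale (*) h"
    "\<forall>b\<in>Basis. g b = h b" for g h
  proof -
    interpret vector_space_pair scale "(*) :: 'k \<Rightarrow> 'k \<Rightarrow> 'k"
      using that(1) by (simp add: vector_space_pair_def Vector_Spaces.linear_def)
    show ?thesis
      using linear_eq_on_span[OF that(1,2), of Basis] that(3) span_Basis by auto
  qed
  have lin: "Vector_Spaces.linear scale scale ?T"
    by unfold_locales
      (simp_all add: form_simps scale_left_distrib sum.distrib scale_sum_right)
  have "inj ?T"
  proof (rule injI)
    fix x y assume "?T x = ?T y"
    then have "\<forall>b\<in>Basis. \<omega> b x = \<omega> b y" by (rule coeffs)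
    then have "(\<lambda>u. \<omega> u x) = (\<lambda>u. \<omega> u y)" by (intro basis_ext form_linear_left)
    then show "x = y" by (intro form_right_cancel) metis
  qed
  then have "surj ?T" using linear_inj_imp_surj[OF lin] by blast
  then obtain w where "?T w = (\<Sum>b\<in>Basis. scale (f b) b)" unfolding surj_def by (metis (no_types))
  then have "\<forall>b\<in>Basis. \<omega> b w = f b" by (rule coeffs)
  then have "f = (\<lambda>u. \<omega> u w)" by (intro basis_ext f form_linear_left) simp
  then show ?thesis by metis
qed

lemma adjoint_ex1:
  assumes F: "Vector_Spaces.linear scale scale F"
  shows "\<exists>!G. \<forall>u v. \<omega> (F u) v = \<omega> u (G v)"
proof -
  have "\<exists>w. \<forall>u. \<omega> (F u) v = \<omega> u w" for v
    using form_represents[OF Vector_Spaces.linear_compose[OF F form_linear_left[of v]]] by (simp add: o_def)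
  then obtain G where G: "\<forall>u v. \<omega> (F u) v = \<omega> u (G v)" by metis
  moreover have "H = G" if "\<forall>u v. \<omega> (F u) v = \<omega> u (H v)" for H
    using that G by (intro ext form_right_cancel) metis
  ultimately show ?thesis by blast
qed

lemma form_adjoint:
  assumes "Vector_Spaces.linear scale scale F"
  shows "\<omega> (F u) v = \<omega> u (form_adjoint \<omega> F v)"
  using theI'[OF adjoint_ex1[OF assms]] unfolding form_adjoint_def by blast

end

end

theory Submission
  imports Defs
begin

text \<open>
  Write \<open>L u = - ad u*\<close> for the left multiplication of \<open>\<alpha>\<^sup>a\<close>. Since \<open>ad\<close> is a representation so
  is \<open>L\<close>, and the cocycle condition says that \<open>L u v - L v u = [u, v]\<close>. Hence \<open>\<alpha>\<^sup>a\<close> is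
  quasi-canonical iff it is bi-invariant, i.e. \<open>[ad u, L v] = L [u, v]\<close>, and \<open>ad [u, v] = 0\<close>.
  The product \<open>\<alpha>\<^sup>s\<close> has left multiplication \<open>S u = (ad u + L u) / 3\<close>, so it is bi-invariant iff \<open>\<alpha>\<^sup>a\<close>
  is; in that case \<open>[S u, S v] - S [u, v] = - (2 / 9) ad [u, v]\<close>, which equals
  \<open>- (1 / 4) ad [u, v]\<close> only if \<open>ad [u, v] = 0\<close>. Under 2-nilpotency \<open>L [u, v] = 0\<close>, so bi-invariance
  becomes \<open>[ad u, L v] = 0\<close>. In that case \<open>L u v = L v u + [u, v]\<close> makes every product with a
  bracket and every bracket with a product vanish, so that \<open>L u (L v w)\<close> is symmetric in \<open>u, v, w\<close>
  and equal to \<open>L (L u v) w\<close>, and triple products for \<open>\<alpha>\<^sup>s\<close> are \<open>1 / 9\<close> of those for \<open>\<alpha>\<^sup>a\<close>.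
\<close>

context symplectic_lie_algebra
begin

section \<open>Calculus of the bracket and the form\<close>

lemma linear_ad: "Vector_Spaces.linear scale scale (ad bracket u)"
  using bracket_bilinear by (simp add: ad_def bilinear_map_def)

lemma bracket_simps:
  "bracket (x + y) v = bracket x v + bracket y v" "bracket (scale c x) v = scale c (bracket x v)"
  "bracket v (x + y) = bracket v x + bracket v y" "bracket v (scale c x) = scale c (bracket v x)"
  using bracket_bilinear by (simp_all add: bilinear_map_def linear_iff_module_hom module_hom_iff)

lemma bracket_skew: "bracket u v = - bracket v u"
  using bracket_alternating[of "u + v"] bracket_alternating[of u] bracket_alternating[of v]
  by (simp add: bracket_simps eq_neg_iff_add_eq_0 add.commute)

lemma bracket_minus: "bracket (- x) v = - bracket x v" "bracket v (- x) = - bracket v x"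
  using bracket_simps(2)[of "- 1" x v] bracket_simps(4)[of v "- 1" x] by simp_all

lemma jacobi_derivation:
  "bracket (bracket u v) w = bracket u (bracket v w) - bracket v (bracket u w)"
proof -
  have "bracket w (bracket u v) = - bracket (bracket u v) w"
    by (rule bracket_skew)
  moreover have "bracket v (bracket w u) = - bracket v (bracket u w)"
    by (subst bracket_skew[of w u]) (simp add: bracket_minus)
  ultimately show ?thesis
    using jacobi[of u v w] by (simp add: algebra_simps)
qed

lemma form_minus: "\<omega> (- x) v = - \<omega> x v" "\<omega> v (- x) = - \<omega> v x"
  using form_simps(2)[of "- 1" x v] form_simps(4)[of v "- 1" x] by simp_all

lemma form_diff: "\<omega> (x - y) v = \<omega> x v - \<omega> y v" "\<omega> v (x - y) = \<omega> v x - \<omega> v y"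
  using form_simps(1)[of x "- y" v] form_simps(3)[of v x "- y"] by (simp_all add: form_minus)

lemma form_zero: "\<omega> 0 v = 0" "\<omega> v 0 = 0"
  using form_diff(1)[of 0 0 v] form_diff(2)[of v 0 0] by simp_all

abbreviation L :: "'v \<Rightarrow> 'v \<Rightarrow> 'v"
  where "L \<equiv> alpha_a bracket \<omega>"

text \<open>Trades \<open>L\<close> for the bracket under the form; with
  \<open>form_right_cancel\<close>, identities for \<open>L\<close> reduce to identities for the
  bracket.\<close>

lemma form_L: "\<omega> v (L u w) = - \<omega> (bracket u v) w"
  using form_adjoint[OF linear_ad[of u], of v w] by (simp add: alpha_a_def form_minus ad_def)

lemma L_simps:
  "L (x + y) v = L x v + L y v" "L (scale c x) v = scale c (L x v)"
  "L v (x + y) = L v x + L v y" "L v (scale c x) = scale c (L v x)"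
  by (rule form_right_cancel, simp add: form_L form_simps bracket_simps)+

lemma L_minus: "L (- x) v = - L x v" "L v (- x) = - L v x"
  using L_simps(2)[of "- 1" x v] L_simps(4)[of v "- 1" x] by simp_all

lemma bilinear_mapI:
  assumes "\<And>x y v. f (x + y) v = f x v + f y v" "\<And>c x v. f (scale c x) v = scale c (f x v)"
    and "\<And>x y v. f v (x + y) = f v x + f v y" "\<And>c x v. f v (scale c x) = scale c (f v x)"
  shows "bilinear_map scale scale f"
  unfolding bilinear_map_def linear_iff_module_hom module_hom_iff
  using assms module_axioms by blast

lemma bilinear_L: "bilinear_map scale scale L"
  by (intro bilinear_mapI L_simps)

lemma L_swap: "L u v = L v u + bracket u v"
proof (rule form_right_cancel)
  fix w
  have "\<omega> (bracket w u) v = - \<omega> (bracket u w) v" "\<omega> w (bracket u v) = - \<omega> (bracket u v) w"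
    by (simp_all add: bracket_skew[of w u] form_minus form_skew[of w "bracket u v"])
  \<comment> \<open>Up to sign, the terms of the cocycle identity are the pairings of
    \<open>w\<close> with \<open>L u v\<close>, \<open>L v u\<close> and
    \<open>bracket u v\<close>.\<close>
  then show "\<omega> w (L u v) = \<omega> w (L v u + bracket u v)"
    unfolding form_L form_simps using form_cocycle[of u v w] by algebra
qed

lemma lie_admissible_L: "lie_admissible bracket L"
  unfolding lie_admissible_def diff_eq_eq by (metis L_swap add.commute)

text \<open>Adjoints reverse composition and the minus sign in \<open>L\<close> compensates, so the
  Jacobi identity for \<open>ad\<close> carries over.\<close>

lemma L_commutator: "L u (L v w) - L v (L u w) = L (bracket u v) w"
  by (rule form_right_cancel) (simp add: form_L form_diff jacobi_derivation)

lemma L_eq_0: "two_nilpotent bracket \<Longrightarrow> L (bracket u v) w = 0"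
  by (rule form_right_cancel) (simp add: form_L two_nilpotent_def form_zero)

lemma commuting_iff:
  "commutator (ad bracket u) (form_adjoint \<omega> (ad bracket v)) = (\<lambda>_. 0) \<longleftrightarrow>
    (\<forall>w. bracket u (L v w) = L v (bracket u w))"
  by (auto simp: commutator_def fun_eq_iff alpha_a_def ad_def bracket_minus)

lemma bi_invariant_L_iff:
  assumes "two_nilpotent bracket"
  shows "bi_invariant bracket L \<longleftrightarrow>
    (\<forall>u v. commutator (ad bracket u) (form_adjoint \<omega> (ad bracket v)) = (\<lambda>_. 0))"
  by (auto simp: bi_invariant_def commuting_iff L_eq_0[OF assms])

end

section \<open>The product \<open>S\<close> and the equivalences in characteristic 0\<close>

locale symplectic_lie_algebra_char_0 = symplectic_lie_algebra scale Basis bracket \<omega>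
  for scale :: "'k::field_char_0 \<Rightarrow> 'v::ab_group_add \<Rightarrow> 'v" and Basis :: "'v set"
    and bracket :: "'v \<Rightarrow> 'v \<Rightarrow> 'v" and \<omega> :: "'v \<Rightarrow> 'v \<Rightarrow> 'k"
begin

abbreviation S :: "'v \<Rightarrow> 'v \<Rightarrow> 'v"
  where "S \<equiv> alpha_s scale bracket \<omega>"

lemma S_eq: "S u v = scale (1 / 3) (bracket u v + L u v)"
  by (simp add: alpha_s_def alpha_a_def ad_def)

lemma bilinear_S: "bilinear_map scale scale S"
  by (rule bilinear_mapI)
    (simp_all add: S_eq bracket_simps L_simps scale_right_distrib scale_left_commute)

text \<open>Antisymmetrizing gives \<open>2 [u, v]\<close> from the bracket and
  \<open>[u, v]\<close> from \<open>L\<close>, which explains the factor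
  \<open>1 / 3\<close>.\<close>

lemma lie_admissible_S: "lie_admissible bracket S"
proof -
  have "S u v - S v u = bracket u v" for u v
  proof -
    have "S u v - S v u = scale (1 / 3) (bracket u v + bracket u v + bracket u v)"
      by (simp add: S_eq L_swap[of u v] bracket_skew[of v u] flip: scale_right_diff_distrib)
    also have "\<dots> = scale (1 / 3 + 1 / 3 + 1 / 3) (bracket u v)"
      by (simp only: scale_right_distrib scale_left_distrib)
    finally show ?thesis by simp
  qed
  then show ?thesis by (simp add: lie_admissible_def)
qed

text \<open>The bracket is itself bi-invariant by Jacobi, so the defect of \<open>S\<close> is one
  third of that of \<open>L\<close>.\<close>

lemma bi_invariant_S_iff: "bi_invariant bracket S \<longleftrightarrow> bi_invariant bracket L"
proof -
  have "bracket u (S v w) - (S (bracket u v) w + S v (bracket u w)) =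
      scale (1 / 3) (bracket u (L v w) - (L (bracket u v) w + L v (bracket u w)))" for u v w
    by (simp add: S_eq bracket_simps jacobi_derivation algebra_simps)
  then have "bracket u (S v w) = S (bracket u v) w + S v (bracket u w) \<longleftrightarrow>
      bracket u (L v w) = L (bracket u v) w + L v (bracket u w)" for u v w
    by (metis eq_iff_diff_eq_0 scale_eq_0_iff divide_eq_0_iff zero_neq_numeral zero_neq_one)
  then show ?thesis by (simp add: bi_invariant_def)
qed

lemma S_curvature:
  assumes "bi_invariant bracket L"
  shows "S u (S v w) - S v (S u w) - S (bracket u v) w = scale (- (2 / 9)) (bracket (bracket u v) w)"
proof -
  let ?a = "bracket (bracket u v) w" and ?l = "L (bracket u v) w"
  have 1: "bracket u (L v w) = ?l + L v (bracket u w)"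
    using assms by (simp add: bi_invariant_def)
  have 2: "bracket v (L u w) = L u (bracket v w) - ?l"
    using assms by (simp add: bi_invariant_def bracket_skew[of v u] L_minus)
  have "S u (S v w) - S v (S u w) =
      scale (1 / 9) (bracket u (bracket v w) - bracket v (bracket u w) + (L u (L v w) - L v (L u w))
        + bracket u (L v w) - L v (bracket u w) + L u (bracket v w) - bracket v (L u w))"
    by (simp add: S_eq bracket_simps L_simps algebra_simps)
  \<comment> \<open>One \<open>?l\<close> comes from \<open>[L u, L v]\<close> and one from each
    mixed commutator \<open>[ad u, L v]\<close> and \<open>[L u, ad v]\<close>; together they cancel
    the \<open>L\<close> part of \<open>S (bracket u v) w\<close>.\<close>
  also have "\<dots> = scale (1 / 9) (?a + ?l + ?l + ?l)"
    by (simp add: 1 2 jacobi_derivation L_commutator)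
  also have "\<dots> = scale (1 / 9) ?a + scale (1 / 9 + 1 / 9 + 1 / 9) ?l"
    by (simp only: scale_right_distrib scale_left_distrib add.assoc)
  finally have "S u (S v w) - S v (S u w) - S (bracket u v) w =
      scale (1 / 9) ?a - scale (1 / 3) ?a"
    by (simp add: S_eq scale_right_distrib)
  then show ?thesis
    by (simp flip: scale_left_diff_distrib)
qed

lemma quasi_canonical_S_iff:
  "quasi_canonical scale bracket S \<longleftrightarrow> bi_invariant bracket L \<and> two_nilpotent bracket"
proof -
  have "scale (- (2 / 9)) x = scale (- (1 / 4)) x \<longleftrightarrow> x = 0" for x
    by (simp add: field_simps)
  then show ?thesis
    unfolding quasi_canonical_def bi_invariant_S_iff
    by (auto simp: bilinear_S lie_admissible_S commutator_def left_mult_def ad_def S_curvature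
        two_nilpotent_def)
qed

lemma quasi_canonical_L_iff:
  "quasi_canonical scale bracket L \<longleftrightarrow> bi_invariant bracket L \<and> two_nilpotent bracket"
  by (auto simp: quasi_canonical_def bilinear_L lie_admissible_L commutator_def
      left_mult_def ad_def L_commutator two_nilpotent_def)

section \<open>Associativity and the LR property\<close>

context
  assumes nil: "two_nilpotent bracket" and inv: "bi_invariant bracket L"
begin

lemma bracket_bracket_eq_0: "bracket (bracket u v) w = 0" "bracket w (bracket u v) = 0"
  using nil bracket_skew[of w "bracket u v"] by (simp_all add: two_nilpotent_def)

lemma L_bracket_eq_0: "L (bracket u v) w = 0" "L w (bracket u v) = 0"
  using L_swap[of w "bracket u v"] by (simp_all add: L_eq_0[OF nil] bracket_bracket_eq_0)

text \<open>Both terms on the right of bi-invariance contain \<open>L\<close> applied to a bracket,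
  hence vanish.\<close>

lemma bracket_L_eq_0: "bracket u (L v w) = 0" "bracket (L v w) u = 0"
  using inv bracket_skew[of "L v w" u] by (simp_all add: bi_invariant_def L_bracket_eq_0)

lemma L_left_commute: "L u (L v w) = L v (L u w)"
  using L_commutator[of u v w] by (simp add: L_bracket_eq_0)

lemma L_L_swap: "L (L u v) w = L w (L u v)" "L w (L u v) = L w (L v u)"
  using L_swap[of "L u v" w] arg_cong[OF L_swap[of u v], of "L w"]
  by (simp_all add: bracket_L_eq_0 L_bracket_eq_0 L_simps)

lemma S_S: "S u (S v w) = scale (1 / 9) (L u (L v w))" "S (S u v) w = scale (1 / 9) (L (L u v) w)"
  by (simp_all add: S_eq bracket_simps L_simps bracket_bracket_eq_0 L_bracket_eq_0 bracket_L_eq_0)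

lemma associative_L: "associative_product L"
proof -
  \<comment> \<open>With juxtaposition for \<open>L\<close>:
    \<open>(uv)w = w(uv) = u(wv) = u(vw)\<close>.\<close>
  have "L (L u v) w = L u (L v w)" for u v w
    unfolding L_L_swap(1)[of u v w] L_left_commute[of w u v] by (rule L_L_swap(2))
  then show ?thesis by (simp add: associative_product_def)
qed

lemma associative_S: "associative_product S"
  using associative_L by (simp add: associative_product_def S_S)

lemma LR_L: "LR_algebra scale L"
proof -
  \<comment> \<open>The claim that right multiplications commute:
    \<open>(xv)u = u(vx) = v(ux) = v(xu) = (xu)v\<close>.\<close>
  have "L (L x v) u = L (L x u) v" for u v x
  proof -
    have "L (L x v) u = L u (L v x)"
      unfolding L_L_swap(1)[of x v u] by (rule L_L_swap(2))
    also have "\<dots> = L v (L x u)"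
      unfolding L_left_commute[of u v x] by (rule L_L_swap(2))
    finally show ?thesis by (simp only: L_L_swap(1)[of x u v])
  qed
  then show ?thesis
    by (simp add: LR_algebra_def bilinear_L commutator_def left_mult_def right_mult_def fun_eq_iff
        L_left_commute)
qed

lemma LR_S: "LR_algebra scale S"
  using LR_L
  by (simp add: LR_algebra_def bilinear_S commutator_def left_mult_def right_mult_def fun_eq_iff S_S)

end

end

theorem proposition5p1:
  fixes scale :: "'k::field_char_0 \<Rightarrow> 'v::ab_group_add \<Rightarrow> 'v"
    and Basis :: "'v set"
    and bracket :: "'v \<Rightarrow> 'v \<Rightarrow> 'v"
    and \<omega> :: "'v \<Rightarrow> 'v \<Rightarrow> 'k"
  assumes "symplectic_lie_algebra scale Basis bracket \<omega>"
  shows "(quasi_canonical scale bracket (alpha_a bracket \<omega>) \<longleftrightarrow>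
      quasi_canonical scale bracket (alpha_s scale bracket \<omega>)) \<and>
    (quasi_canonical scale bracket (alpha_s scale bracket \<omega>) \<longleftrightarrow>
      two_nilpotent bracket \<and>
      (\<forall>u v. commutator (ad bracket u) (form_adjoint \<omega> (ad bracket v)) = (\<lambda>_. 0))) \<and>
    (quasi_canonical scale bracket (alpha_a bracket \<omega>) \<or>
     quasi_canonical scale bracket (alpha_s scale bracket \<omega>) \<or>
     (two_nilpotent bracket \<and>
      (\<forall>u v. commutator (ad bracket u) (form_adjoint \<omega> (ad bracket v)) = (\<lambda>_. 0))) \<longrightarrow>
      associative_product (alpha_a bracket \<omega>) \<and> LR_algebra scale (alpha_a bracket \<omega>) \<and>
      associative_product (alpha_s scale bracket \<omega>) \<and> LR_algebra scale (alpha_s scale bracket \<omega>))"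
proof -
  interpret symplectic_lie_algebra_char_0 scale Basis bracket \<omega>
    using assms by (rule symplectic_lie_algebra_char_0.intro)
  let ?N = "two_nilpotent bracket" and ?B = "bi_invariant bracket L"
    and ?C = "\<forall>u v. commutator (ad bracket u) (form_adjoint \<omega> (ad bracket v)) = (\<lambda>_. 0)"
  have *: "?N \<and> ?C \<longleftrightarrow> ?B \<and> ?N"
    using bi_invariant_L_iff by blast
  show ?thesis
    unfolding quasi_canonical_L_iff quasi_canonical_S_iff *
    using associative_L associative_S LR_L LR_S by simp
qed

end
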